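(* (i) Let $S_1$ be any signed graph on $n_1$ vertices with $t_1$ $(1\le t_1\le n_1)$ distinct adjacency eigenvalues and let $S_2$ be a net regular signed graph on $n_2$ vertices with $t_2$ $(1\le t_2\le n_2)$ distinct adjacency eigenvalues. Then the adjacency spectrum of $S_1\star_s S_2$ consists of at most $2t_1+t_2$ distinct eigenvalues. (ii) Let $S_1$ be any regular signed graph on $n_1$ vertices with $t_1$ $(1\le t_1\le n_1)$ distinct Laplacian eigenvalues and let $S_2$ be a regular and net regular signed graph on $n_2$ vertices with $t_2$ $(1\le t_2\le n_2)$ distinct Laplacian eigenvalues. Then the Laplacian spectrum of $S_1\star_s S_2$ consists of at most $2t_1+t_2$ distinct eigenvalues. (iii) Let $S_1$ be any net regular signed graph on $n_1$ vertices with $t_1$ $(1\le t_1\le n_1)$ distinct net Laplacian eigenvalues and let $S_2$ be any signed graph on $n_2$ vertices with $t_2$ $(1\le t_2\le n_2)$ distinct net Laplacian eigenvalues. Then the net Laplacian spectrum of $S_1\star_s S_2$ consists of at most $2t_1+t_2$ distinct eigenvalues.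
   Context: A signed graph $S=(G,\sigma)$ is a finite simple graph $G$ with a sign function $\sigma:E_G\to\{-1,1\}$. Its adjacency matrix $A_S$ has $(i,j)$ entry $\sigma(v_iv_j)$ if $v_i\sim v_j$ and $0$ otherwise. $D_S$ is the diagonal matrix of vertex degrees (degrees in $G$) and $L_S=D_S-A_S$ is the Laplacian matrix. The net-degree of a vertex is the number of positive edges minus the number of negative edges incident with it; $D^{\pm}_S$ is the diagonal matrix of net-degrees and $N_S=D^{\pm}_S-A_S$ is the net Laplacian matrix. The adjacency, Laplacian and net Laplacian eigenvalues/spectra are those of $A_S$, $L_S$, $N_S$. $S$ is regular if $G$ is regular, and net regular if all vertices have the same net-degree. The s-neighbourhood corona $S_1\star_s S_2$ of signed graphs $S_1=(G_1,\sigma_1)$ (vertices $v_1,\dots,v_{n_1}$) and $S_2$ (with $n_2$ vertices) is the signed graph on $n_1(n_2+1)$ vertices obtained by taking one copy of $S_1$ and $n_1$ disjoint copies of $S_2$, and, for each $i$ and each neighbour $v_h$ of $v_i$ in $S_1$, joining $v_h$ to every vertex of the $i$th copy of $S_2$ by an edge of sign $\sigma_1(v_hv_i)$. *)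

theory Defs
  imports "HOL-Analysis.Analysis"
begin

text \<open>
  The vertex set is the finite type \<open>'v\<close>; types being nonempty, there is no null graph.
  The value of the sign function matters on edges only.
\<close>

record 'v pre_signed_graph =
  adj :: "'v \<Rightarrow> 'v \<Rightarrow> bool"
  sign :: "'v \<Rightarrow> 'v \<Rightarrow> int"

definition signed_graph :: "'v::finite pre_signed_graph \<Rightarrow> bool" where
  "signed_graph S \<longleftrightarrow>
     (\<forall>u. \<not> adj S u u) \<and>
     (\<forall>u v. adj S u v \<longrightarrow> adj S v u) \<and>
     (\<forall>u v. adj S u v \<longrightarrow> sign S u v = sign S v u) \<and>
     (\<forall>u v. adj S u v \<longrightarrow> sign S u v \<in> {-1, 1})"

definition vdegree :: "'v::finite pre_signed_graph \<Rightarrow> 'v \<Rightarrow> nat" where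
  "vdegree S v = card {w. adj S v w}"

definition net_degree :: "'v::finite pre_signed_graph \<Rightarrow> 'v \<Rightarrow> int" where
  "net_degree S v =
     int (card {w. adj S v w \<and> sign S v w = 1}) - int (card {w. adj S v w \<and> sign S v w = -1})"

definition regular :: "'v::finite pre_signed_graph \<Rightarrow> bool" where
  "regular S \<longleftrightarrow> (\<exists>r. \<forall>v. vdegree S v = r)"

definition net_regular :: "'v::finite pre_signed_graph \<Rightarrow> bool" where
  "net_regular S \<longleftrightarrow> (\<exists>r. \<forall>v. net_degree S v = r)"

definition diagonal_matrix :: "('v::finite \<Rightarrow> real) \<Rightarrow> real^'v^'v" where
  "diagonal_matrix d = (\<chi> i j. if i = j then d i else 0)"

definition adjacency_matrix :: "'v::finite pre_signed_graph \<Rightarrow> real^'v^'v" where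
  "adjacency_matrix S = (\<chi> i j. if adj S i j then of_int (sign S i j) else 0)"

definition laplacian_matrix :: "'v::finite pre_signed_graph \<Rightarrow> real^'v^'v" where
  "laplacian_matrix S = diagonal_matrix (\<lambda>v. real (vdegree S v)) - adjacency_matrix S"

definition net_laplacian_matrix :: "'v::finite pre_signed_graph \<Rightarrow> real^'v^'v" where
  "net_laplacian_matrix S = diagonal_matrix (\<lambda>v. of_int (net_degree S v)) - adjacency_matrix S"

text \<open>
  The set of distinct eigenvalues. Restricting to real eigenvalues loses nothing for the matrices
  above, which are real symmetric.
\<close>

definition eigenvalue :: "real^'n^'n \<Rightarrow> real \<Rightarrow> bool" where
  "eigenvalue A \<mu> \<longleftrightarrow> (\<exists>x. x \<noteq> 0 \<and> A *v x = \<mu> *s x)"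

definition spectrum :: "real^'n^'n \<Rightarrow> real set" where
  "spectrum A = {\<mu>. eigenvalue A \<mu>}"

text \<open>
  In the s-neighbourhood corona, \<open>Inl h\<close> is the vertex \<open>h\<close> of the copy of the first graph and
  \<open>Inr (i, u)\<close> is the vertex \<open>u\<close> of the \<open>i\<close>-th copy of the second graph. The vertex type
  \<open>'a + 'a \<times> 'b\<close> has \<open>CARD('a) * (CARD('b) + 1)\<close> elements.
\<close>

fun s_corona_adj ::
  "'a pre_signed_graph \<Rightarrow> 'b pre_signed_graph \<Rightarrow> 'a + 'a \<times> 'b \<Rightarrow> 'a + 'a \<times> 'b \<Rightarrow> bool" where
  "s_corona_adj S1 S2 (Inl g) (Inl h) = adj S1 g h"
| "s_corona_adj S1 S2 (Inl h) (Inr (i, u)) = adj S1 h i"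
| "s_corona_adj S1 S2 (Inr (i, u)) (Inl h) = adj S1 h i"
| "s_corona_adj S1 S2 (Inr (i, u)) (Inr (j, w)) = (i = j \<and> adj S2 u w)"

fun s_corona_sign ::
  "'a pre_signed_graph \<Rightarrow> 'b pre_signed_graph \<Rightarrow> 'a + 'a \<times> 'b \<Rightarrow> 'a + 'a \<times> 'b \<Rightarrow> int" where
  "s_corona_sign S1 S2 (Inl g) (Inl h) = sign S1 g h"
| "s_corona_sign S1 S2 (Inl h) (Inr (i, u)) = sign S1 h i"
| "s_corona_sign S1 S2 (Inr (i, u)) (Inl h) = sign S1 h i"
| "s_corona_sign S1 S2 (Inr (i, u)) (Inr (j, w)) = sign S2 u w"

definition s_neighbourhood_corona ::
  "'a::finite pre_signed_graph \<Rightarrow> 'b::finite pre_signed_graph \<Rightarrow> ('a + 'a \<times> 'b) pre_signed_graph"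
  (infixl \<open>\<star>\<^sub>s\<close> 70) where
  "S1 \<star>\<^sub>s S2 = \<lparr>adj = s_corona_adj S1 S2, sign = s_corona_sign S1 S2\<rparr>"

lemma signed_graph_s_neighbourhood_corona:
  fixes S1 :: "'a::finite pre_signed_graph" and S2 :: "'b::finite pre_signed_graph"
  assumes S1: "signed_graph S1" and S2: "signed_graph S2"
  shows "signed_graph (S1 \<star>\<^sub>s S2)"
proof -
  let ?A = "s_corona_adj S1 S2" and ?s = "s_corona_sign S1 S2"
  have "\<not> ?A u u" for u
    using S1 S2 by (cases u) (auto simp: signed_graph_def)
  moreover have "?A v u \<and> ?s u v = ?s v u \<and> ?s u v \<in> {-1, 1}" if "?A u v" for u v
    using that S1 S2 unfolding signed_graph_def
    by (cases "(S1, S2, u, v)" rule: s_corona_adj.cases) (auto; metis)+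
  ultimately show ?thesis
    by (auto simp: signed_graph_def s_neighbourhood_corona_def)
qed

end

theory Submission
  imports Defs
begin

text \<open>
  Each of the three matrices of the corona has the block form
  \<open>[[a I + B, B \<otimes> 1\<^sup>T], [B \<otimes> 1, I \<otimes> (b I + K)]]\<close>, where \<open>B\<close> is plus or minus the adjacency matrix
  of the first graph and the symmetric matrix \<open>K\<close> of the second graph satisfies \<open>K 1 = k 1\<close>.
  Let \<open>(x, y)\<close> be an eigenvector for \<open>\<mu>\<close>, and suppose that \<open>\<mu> - b\<close> is not an eigenvalue of \<open>K\<close>;
  in particular \<open>\<mu> - b \<noteq> k\<close>. Summing the equations of each copy of the second graph
  eliminates \<open>y\<close> and shows that \<open>x \<noteq> 0\<close> is annihilated by
  \<open>n\<^sub>2 B\<^sup>2 + (\<mu> - b - k) B + (\<mu> - b - k) (a - \<mu>) I\<close>. As \<open>B\<close> is symmetric, some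
  eigenvalue \<open>\<theta>\<close> of \<open>B\<close> is a root of this polynomial. The relation between \<open>\<theta>\<close> and \<open>\<mu>\<close> is quadratic
  in \<open>\<mu>\<close>, so each \<open>\<theta>\<close> accounts for at most two values \<open>\<mu>\<close>.
\<close>

section \<open>Root counts and unions of finite sets\<close>

lemma quadratic_roots_finite_card_le_2:
  fixes p q :: "'a::idom"
  shows "finite {x. x\<^sup>2 + p * x + q = 0} \<and> card {x. x\<^sup>2 + p * x + q = 0} \<le> 2"
proof (cases "{x. x\<^sup>2 + p * x + q = 0} = {}")
  case True
  then show ?thesis
    by simp
next
  case False
  then obtain z where z: "z\<^sup>2 + p * z + q = 0"
    by blast
  \<comment> \<open>By Vieta, once \<open>z\<close> is a root the only other candidate is
    \<open>- p - z\<close>.\<close>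
  have "{x. x\<^sup>2 + p * x + q = 0} \<subseteq> {z, - p - z}"
  proof
    fix x
    assume "x \<in> {x. x\<^sup>2 + p * x + q = 0}"
    with z have "(x - z) * (x - (- p - z)) = 0"
      by simp algebra
    then show "x \<in> {z, - p - z}"
      unfolding mult_eq_0_iff eq_iff_diff_eq_0 [symmetric] by simp
  qed
  moreover have "card {z, - p - z} \<le> 2"
    by (simp add: card_insert_if)
  ultimately show ?thesis
    by (meson card_mono finite.emptyI finite_insert finite_subset order_trans)
qed

lemma finite_card_UNION_le:
  assumes "finite I" and "\<And>i. i \<in> I \<Longrightarrow> finite (A i) \<and> card (A i) \<le> n"
  shows "finite (\<Union>i\<in>I. A i) \<and> card (\<Union>i\<in>I. A i) \<le> n * card I"
proof
  show "finite (\<Union>i\<in>I. A i)"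
    using assms by blast
  have "card (\<Union>i\<in>I. A i) \<le> (\<Sum>i\<in>I. card (A i))"
    by (rule card_UN_le [OF assms(1)])
  also have "\<dots> \<le> n * card I"
    using sum_bounded_above [of I "\<lambda>i. card (A i)" n] assms(2) by (simp add: mult.commute)
  finally show "card (\<Union>i\<in>I. A i) \<le> n * card I" .
qed

section \<open>Eigenvalues under shifts and quadratic polynomials\<close>

lemma spectrum_scalar_add:
  fixes A :: "real^'n^'n"
  shows "spectrum (c *\<^sub>R mat 1 + A) = (\<lambda>\<mu>. c + \<mu>) ` spectrum A"
proof -
  have iff: "\<mu> \<in> spectrum (c *\<^sub>R mat 1 + A) \<longleftrightarrow> \<mu> - c \<in> spectrum A" for \<mu>
  proof -
    have "(c *\<^sub>R mat 1 + A) *v x = \<mu> *s x \<longleftrightarrow> A *v x = (\<mu> - c) *s x" for x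
      by (auto simp: scalar_mult_eq_scaleR matrix_vector_mult_add_rdistrib algebra_simps
          simp flip: scaleR_matrix_vector_assoc)
    then show ?thesis
      by (simp add: spectrum_def eigenvalue_def)
  qed
  show ?thesis
  proof (intro set_eqI iffI)
    fix \<mu>
    assume "\<mu> \<in> spectrum (c *\<^sub>R mat 1 + A)"
    then show "\<mu> \<in> (\<lambda>\<mu>. c + \<mu>) ` spectrum A"
      unfolding iff by (rule rev_image_eqI) simp
  qed (auto simp: iff)
qed

text \<open>If the first graph is regular (net regular), its Laplacian (net Laplacian) is a scalar
  matrix minus the adjacency matrix. Its eigenvalue count thus carries over to the negated adjacency
  matrix, the block \<open>B\<close> of the corona.\<close>

lemma card_spectrum_scalar_add:
  fixes A :: "real^'n^'n"
  shows "card (spectrum (c *\<^sub>R mat 1 + A)) = card (spectrum A)"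
  unfolding spectrum_scalar_add by (rule card_image) simp

text \<open>
  Completing the square: a negative discriminant is impossible because \<open>B\<close> is symmetric, and
  otherwise the polynomial splits into linear factors, one of which kills a nonzero vector.
\<close>

lemma symmetric_matrix_quadratic_eigenvalue:
  fixes B :: "real^'n^'n"
  assumes sym: "transpose B = B" and "x \<noteq> 0" and "n \<noteq> 0"
    and eq: "n *\<^sub>R (B *v (B *v x)) + p *\<^sub>R (B *v x) + q *\<^sub>R x = 0"
  shows "\<exists>\<theta>\<in>spectrum B. n * \<theta>\<^sup>2 + p * \<theta> + q = 0"
proof -
  \<comment> \<open>Chosen so that \<open>n * \<theta>\<^sup>2 + p * \<theta> + q = n * ((\<theta> +
    m)\<^sup>2 - D)\<close>; the hypothesis then says that \<open>?T\<close>, which is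
    \<open>B + m I\<close>, squares to \<open>D\<close> on \<open>x\<close>.\<close>
  define m where "m = p / (2 * n)"
  define D where "D = m\<^sup>2 - q / n"
  let ?T = "\<lambda>v. B *v v + m *\<^sub>R v"
  have p: "p = 2 * n * m" and q: "q = n * (m\<^sup>2 - D)"
    using \<open>n \<noteq> 0\<close> by (simp_all add: m_def D_def field_simps)
  have "n * (?T (?T x) - D *\<^sub>R x) $ i = 0" for i
  proof -
    have "n * (B *v (B *v x)) $ i + 2 * n * m * (B *v x) $ i + n * (m\<^sup>2 - D) * x $ i = 0"
      using arg_cong [OF eq, of "\<lambda>v. v $ i"] unfolding p q by simp
    then show ?thesis
      by (simp add: matrix_vector_right_distrib matrix_vector_mult_scaleR) algebra
  qed
  then have TT: "?T (?T x) = D *\<^sub>R x"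
    using \<open>n \<noteq> 0\<close> by (simp add: vec_eq_iff)
  have T_sym: "?T v \<bullet> w = v \<bullet> ?T w" for v w
    using sym dot_lmul_matrix [of v B w]
    by (simp add: inner_add_left inner_add_right) (metis vector_transpose_matrix)
  have "D * (x \<bullet> x) = ?T x \<bullet> ?T x"
    using T_sym [of "?T x" x] TT by simp
  then have "0 \<le> D"
    using \<open>x \<noteq> 0\<close> by (metis inner_ge_zero inner_gt_zero_iff zero_le_mult_iff not_less)
  define s where "s = sqrt D"
  have s: "s\<^sup>2 = D"
    using \<open>0 \<le> D\<close> by (simp add: s_def)
  have root: "n * (t - m)\<^sup>2 + p * (t - m) + q = 0" if "t\<^sup>2 = D" for t
    unfolding p q that [symmetric] by (simp add: power2_eq_square algebra_simps)
  have eigen: "t - m \<in> spectrum B" if "?T v = t *\<^sub>R v" "v \<noteq> 0" for v t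
    using that unfolding spectrum_def eigenvalue_def
    by (auto simp: scalar_mult_eq_scaleR algebra_simps eq_diff_eq)
  show ?thesis
  proof (cases "?T x = s *\<^sub>R x")
    case True
    then show ?thesis
      using eigen [OF True \<open>x \<noteq> 0\<close>] root [of s] s by blast
  next
    case False
    \<comment> \<open>Since \<open>(?T + s) (?T - s) x = 0\<close>, the nonzero vector
      \<open>?T x - s *\<^sub>R x\<close> is an eigenvector of \<open>?T\<close> for
      \<open>- s\<close>.\<close>
    have "?T (?T x - s *\<^sub>R x) = ?T (?T x) - s *\<^sub>R ?T x"
      by (simp add: matrix_vector_mult_diff_distrib matrix_vector_mult_scaleR algebra_simps)
    also have "\<dots> = (- s) *\<^sub>R (?T x - s *\<^sub>R x)"
      unfolding TT s [symmetric] by (simp add: algebra_simps power2_eq_square)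
    finally show ?thesis
      using eigen [of "?T x - s *\<^sub>R x" "- s"] False root [of "- s"] s by auto
  qed
qed

section \<open>The common block matrix and its spectrum\<close>

text \<open>The shift \<open>a\<close> stays apart from \<open>B\<close> because the off-diagonal
  blocks repeat \<open>B\<close> without it; \<open>b\<close> stays apart from \<open>K\<close> so
  that \<open>K\<close> can be the very matrix of the second graph whose eigenvalues are
  counted.\<close>

definition corona_matrix :: "real \<Rightarrow> real \<Rightarrow> real^'a^'a \<Rightarrow> real^'b^'b \<Rightarrow>
    real^('a::finite + 'a \<times> 'b::finite)^('a + 'a \<times> 'b)" where
  "corona_matrix a b B K = (\<chi> p q.
     case p of
       Inl g \<Rightarrow> (case q of Inl h \<Rightarrow> (if g = h then a else 0) + B $ g $ h | Inr (i, u) \<Rightarrow> B $ g $ i)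
     | Inr (i, u) \<Rightarrow> (case q of Inl h \<Rightarrow> B $ i $ h
         | Inr (j, w) \<Rightarrow> if i = j then (if u = w then b else 0) + K $ u $ w else 0))"

lemma sum_corona_vertices:
  fixes f :: "'a::finite + 'a \<times> 'b::finite \<Rightarrow> 'c::comm_monoid_add"
  shows "(\<Sum>p\<in>UNIV. f p) = (\<Sum>h\<in>UNIV. f (Inl h)) + (\<Sum>i\<in>UNIV. \<Sum>u\<in>UNIV. f (Inr (i, u)))"
proof -
  have "(\<Sum>p\<in>UNIV. f p) = (\<Sum>h\<in>UNIV. f (Inl h)) + (\<Sum>p\<in>UNIV. f (Inr p))"
    unfolding UNIV_Plus_UNIV [symmetric] by (subst sum.Plus) auto
  then show ?thesis
    by (simp add: sum.cartesian_product)
qed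

lemma sum_if_eq_mult:
  fixes f :: "'n::finite \<Rightarrow> 'c::semiring_1"
  shows "(\<Sum>j\<in>UNIV. (if i = j then c else 0) * f j) = c * f i"
  by (simp add: if_distrib [of "\<lambda>c. c * _"] cong: if_cong)

lemma corona_matrix_mult_Inl:
  "(corona_matrix a b B K *v z) $ Inl g =
     a * z $ Inl g + (B *v (\<chi> h. z $ Inl h)) $ g + (B *v (\<chi> i. \<Sum>u\<in>UNIV. z $ Inr (i, u))) $ g"
  by (simp add: corona_matrix_def matrix_vector_mult_def sum_corona_vertices distrib_right
      sum.distrib sum_if_eq_mult sum_distrib_left)

lemma corona_matrix_mult_Inr:
  "(corona_matrix a b B K *v z) $ Inr (i, u) =
     (B *v (\<chi> h. z $ Inl h)) $ i + b * z $ Inr (i, u) + (K *v (\<chi> w. z $ Inr (i, w))) $ u"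
proof -
  have "(\<Sum>j\<in>UNIV. \<Sum>w\<in>UNIV. (if i = j then (if u = w then b else 0) + K $ u $ w else 0)
          * z $ Inr (j, w)) =
        (\<Sum>j\<in>UNIV. if i = j then \<Sum>w\<in>UNIV. ((if u = w then b else 0) + K $ u $ w)
          * z $ Inr (j, w) else 0)"
    by (intro sum.cong) auto
  then show ?thesis
    by (simp add: corona_matrix_def matrix_vector_mult_def sum_corona_vertices distrib_right
        sum.distrib sum_if_eq_mult)
qed

lemma spectrum_corona_matrix_subset:
  fixes B :: "real^'a^'a" and K :: "real^'b^'b"
  assumes B: "transpose B = B" and K: "transpose K = K" and k: "K *v 1 = k *\<^sub>R 1"
  shows "spectrum (corona_matrix a b B K) \<subseteq> (\<lambda>\<kappa>. b + \<kappa>) ` spectrum K \<union>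
    (\<Union>\<theta>\<in>spectrum B. {\<mu>. real CARD('b) * \<theta>\<^sup>2 + (\<mu> - b - k) * \<theta> + (\<mu> - b - k) * (a - \<mu>) = 0})"
proof
  fix \<mu>
  assume \<mu>: "\<mu> \<in> spectrum (corona_matrix a b B K)"
  show "\<mu> \<in> (\<lambda>\<kappa>. b + \<kappa>) ` spectrum K \<union>
    (\<Union>\<theta>\<in>spectrum B. {\<mu>. real CARD('b) * \<theta>\<^sup>2 + (\<mu> - b - k) * \<theta> + (\<mu> - b - k) * (a - \<mu>) = 0})"
  proof (cases "\<mu> - b \<in> spectrum K")
    case True
    then show ?thesis
      by (intro UnI1 image_eqI [of _ _ "\<mu> - b"]) auto
  next
    case False
    then have no_eigenvector: "y = 0" if "K *v y = (\<mu> - b) *\<^sub>R y" for y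
      using that by (auto simp: spectrum_def eigenvalue_def scalar_mult_eq_scaleR)
    from \<mu> obtain z where "z \<noteq> 0" and z: "corona_matrix a b B K *v z = \<mu> *\<^sub>R z"
      by (auto simp: spectrum_def eigenvalue_def scalar_mult_eq_scaleR)
    define x where "x = (\<chi> h. z $ Inl h)"
    define y where "y i = (\<chi> u. z $ Inr (i, u))" for i
    \<comment> \<open>Row \<open>Inl g\<close> has the same entry at all vertices of a copy, so
      \<open>y i\<close> enters there only through its sum.\<close>
    define s where "s = (\<chi> i. \<Sum>u\<in>UNIV. z $ Inr (i, u))"
    have top: "B *v x + B *v s = (\<mu> - a) *\<^sub>R x"
      using arg_cong [OF z, of "\<lambda>v. v $ Inl _"]
      by (simp add: vec_eq_iff corona_matrix_mult_Inl x_def s_def algebra_simps)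
    have bottom: "K *v y i = (\<mu> - b) *\<^sub>R y i - (B *v x) $ i *\<^sub>R 1" for i
      using arg_cong [OF z, of "\<lambda>v. v $ Inr (i, _)"]
      by (simp add: vec_eq_iff corona_matrix_mult_Inr x_def y_def algebra_simps)
    \<comment> \<open>With \<open>x = 0\<close>, \<open>bottom\<close> becomes the equation in
      \<open>no_eigenvector\<close>, so every \<open>y i\<close>, and with it \<open>z\<close>,
      would vanish.\<close>
    have "x \<noteq> 0"
    proof
      assume "x = 0"
      then have "y i = 0" for i
        using bottom [of i] no_eigenvector by simp
      with \<open>x = 0\<close> have "z $ p = 0" for p
        by (cases p) (auto simp: x_def y_def vec_eq_iff)
      with \<open>z \<noteq> 0\<close> show False
        by (simp add: vec_eq_iff)
    qed
    have sums: "1 \<bullet> y i = s $ i" for i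
      by (simp add: inner_vec_def y_def s_def)
    have one: "(1 :: real^'b) \<bullet> 1 = real CARD('b)"
      by (simp add: inner_vec_def)
    \<comment> \<open>Pairing \<open>bottom\<close> with the all-ones vector, an eigenvector of the
      symmetric \<open>K\<close>, leaves only the sum \<open>s $ i\<close> of
      \<open>y i\<close>.\<close>
    have "(\<mu> - b - k) *\<^sub>R s = real CARD('b) *\<^sub>R (B *v x)"
    proof -
      have "(\<mu> - b - k) * s $ i = real CARD('b) * (B *v x) $ i" for i
      proof -
        have "k * s $ i = (K *v 1) \<bullet> y i"
          by (simp add: k sums)
        also have "\<dots> = 1 \<bullet> (K *v y i)"
          by (metis K dot_lmul_matrix vector_transpose_matrix)
        also have "\<dots> = (\<mu> - b) * s $ i - (B *v x) $ i * real CARD('b)"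
          by (simp add: bottom inner_diff_right sums one)
        finally show ?thesis
          by (simp add: algebra_simps)
      qed
      then show ?thesis
        by (simp add: vec_eq_iff)
    qed
    then have Bs: "(\<mu> - b - k) *\<^sub>R (B *v s) = real CARD('b) *\<^sub>R (B *v (B *v x))"
      by (metis matrix_vector_mult_scaleR)
    \<comment> \<open>Scaling \<open>top\<close> by \<open>\<mu> - b - k\<close> lets
      \<open>Bs\<close> eliminate \<open>s\<close> without a division.\<close>
    have "(\<mu> - b - k) *\<^sub>R (B *v x + B *v s) = ((\<mu> - b - k) * (\<mu> - a)) *\<^sub>R x"
      unfolding top by simp
    then have "real CARD('b) *\<^sub>R (B *v (B *v x)) + (\<mu> - b - k) *\<^sub>R (B *v x)
        + ((\<mu> - b - k) * (a - \<mu>)) *\<^sub>R x = 0"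
      unfolding scaleR_add_right Bs by (simp add: algebra_simps)
    from symmetric_matrix_quadratic_eigenvalue [OF B \<open>x \<noteq> 0\<close> _ this] show ?thesis
      by auto
  qed
qed

lemma card_spectrum_corona_matrix:
  fixes B :: "real^'a^'a" and K :: "real^'b^'b"
  assumes B: "transpose B = B" and K: "transpose K = K" and k: "K *v 1 = k *\<^sub>R 1"
    and "finite (spectrum B)" and "finite (spectrum K)"
  shows "finite (spectrum (corona_matrix a b B K)) \<and>
    card (spectrum (corona_matrix a b B K)) \<le> 2 * card (spectrum B) + card (spectrum K)"
proof -
  let ?U = "(\<lambda>\<kappa>. b + \<kappa>) ` spectrum K"
  let ?R = "\<lambda>\<theta>. {\<mu>. real CARD('b) * \<theta>\<^sup>2 + (\<mu> - b - k) * \<theta> + (\<mu> - b - k) * (a - \<mu>) = 0}"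
  \<comment> \<open>For fixed \<open>\<theta>\<close>, negating the relation makes it a monic
    quadratic in \<open>\<mu>\<close>.\<close>
  have "?R \<theta> = {\<mu>. \<mu>\<^sup>2 + (- a - b - k - \<theta>) * \<mu>
      + ((b + k) * a + (b + k) * \<theta> - real CARD('b) * \<theta>\<^sup>2) = 0}" for \<theta>
    by (rule Collect_cong) (simp add: power2_eq_square, algebra)
  then have "finite (?R \<theta>) \<and> card (?R \<theta>) \<le> 2" for \<theta>
    by (simp only: quadratic_roots_finite_card_le_2)
  then have R: "finite (\<Union>\<theta>\<in>spectrum B. ?R \<theta>) \<and> card (\<Union>\<theta>\<in>spectrum B. ?R \<theta>) \<le> 2 * card (spectrum B)"
    by (rule finite_card_UNION_le [OF \<open>finite (spectrum B)\<close>])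
  have U: "finite ?U \<and> card ?U \<le> card (spectrum K)"
    using \<open>finite (spectrum K)\<close> card_image_le by blast
  have fin: "finite (?U \<union> (\<Union>\<theta>\<in>spectrum B. ?R \<theta>))"
    using R U by simp
  have "card (spectrum (corona_matrix a b B K)) \<le> card (?U \<union> (\<Union>\<theta>\<in>spectrum B. ?R \<theta>))"
    by (rule card_mono [OF fin spectrum_corona_matrix_subset [OF B K k]])
  also have "\<dots> \<le> card ?U + card (\<Union>\<theta>\<in>spectrum B. ?R \<theta>)"
    by (rule card_Un_le)
  finally show ?thesis
    using R U finite_subset [OF spectrum_corona_matrix_subset [OF B K k] fin] by linarith
qed

section \<open>Degrees and matrices of the corona\<close>

lemma vdegree_eq_sum: "real (vdegree S v) = (\<Sum>w\<in>UNIV. if adj S v w then 1 else 0)"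
  by (simp add: vdegree_def sum.If_cases)

lemma net_degree_eq_sum:
  assumes "signed_graph S"
  shows "of_int (net_degree S v) = (\<Sum>w\<in>UNIV. adjacency_matrix S $ v $ w)"
proof -
  have "adjacency_matrix S $ v $ w =
      (if adj S v w \<and> sign S v w = 1 then 1 else 0)
      - (if adj S v w \<and> sign S v w = -1 then 1 else 0)" for w
    using assms by (auto simp: adjacency_matrix_def signed_graph_def)
  then show ?thesis
    by (simp add: net_degree_def sum_subtractf sum.If_cases)
qed

lemma transpose_adjacency_matrix:
  "signed_graph S \<Longrightarrow> transpose (adjacency_matrix S) = adjacency_matrix S"
  by (auto simp: signed_graph_def transpose_def adjacency_matrix_def vec_eq_iff)

lemma transpose_diff: "transpose (A - B) = transpose A - transpose (B :: real^'n^'m)"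
  by (simp add: transpose_def vec_eq_iff)

lemma transpose_diagonal_matrix: "transpose (diagonal_matrix d) = diagonal_matrix d"
  by (auto simp: transpose_def diagonal_matrix_def vec_eq_iff)

lemma diagonal_matrix_mult_one: "(diagonal_matrix d *v 1) $ v = d v"
  by (simp add: diagonal_matrix_def matrix_vector_mult_def)

lemma diagonal_matrix_const: "diagonal_matrix (\<lambda>_. c) = c *\<^sub>R mat 1"
  by (simp add: diagonal_matrix_def mat_def vec_eq_iff)

text \<open>Net regularity thus makes the all-ones vector an eigenvector, the condition imposed on
  the block \<open>K\<close>.\<close>

lemma adjacency_matrix_mult_one:
  "signed_graph S \<Longrightarrow> (adjacency_matrix S *v 1) $ v = of_int (net_degree S v)"
  by (simp add: net_degree_eq_sum matrix_vector_mult_def)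

text \<open>The corona reads \<open>S1\<close> at \<open>(h, i)\<close> in both directions, whereas
  \<open>corona_matrix\<close> has \<open>B $ i $ h\<close> in the lower left block; the symmetry of
  \<open>S1\<close> reconciles the two.\<close>

lemma adjacency_matrix_s_corona:
  assumes "signed_graph S1"
  shows "adjacency_matrix (S1 \<star>\<^sub>s S2) =
    corona_matrix 0 0 (adjacency_matrix S1) (adjacency_matrix S2)"
  using assms unfolding vec_eq_iff signed_graph_def
  by (auto simp: adjacency_matrix_def corona_matrix_def s_neighbourhood_corona_def
      split: sum.splits)

text \<open>Regularity or net regularity of the first graph supplies the constants: a vertex of a
  copy gets \<open>b\<close> from its edges to the first graph and \<open>e u\<close> from those
  inside its copy.\<close>

lemma corona_matrix_diagonal_diff:
  assumes "\<And>h. d (Inl h) = a" and "\<And>i u. d (Inr (i, u)) = b + e u"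
  shows "diagonal_matrix d - corona_matrix 0 0 B K = corona_matrix a b (- B) (diagonal_matrix e - K)"
  using assms unfolding vec_eq_iff
  by (auto simp: diagonal_matrix_def corona_matrix_def split: sum.splits)

lemma vdegree_s_corona:
  fixes S1 :: "'a::finite pre_signed_graph" and S2 :: "'b::finite pre_signed_graph"
  assumes "signed_graph S1"
  shows "real (vdegree (S1 \<star>\<^sub>s S2) (Inl h)) = (1 + real CARD('b)) * real (vdegree S1 h)"
    and "real (vdegree (S1 \<star>\<^sub>s S2) (Inr (i, u))) = real (vdegree S1 i) + real (vdegree S2 u)"
proof -
  \<comment> \<open>A vertex of copy \<open>i\<close> is joined to each \<open>h\<close> with
    \<open>adj S1 h i\<close>, while the degree of \<open>i\<close> counts
    \<open>adj S1 i h\<close>.\<close>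
  have sym: "adj S1 g i \<longleftrightarrow> adj S1 i g" for g
    using assms by (auto simp: signed_graph_def)
  show "real (vdegree (S1 \<star>\<^sub>s S2) (Inl h)) = (1 + real CARD('b)) * real (vdegree S1 h)"
    unfolding vdegree_eq_sum sum_corona_vertices
    by (simp add: s_neighbourhood_corona_def sum_distrib_left [symmetric] distrib_right)
  have "(\<Sum>j\<in>UNIV. \<Sum>w\<in>UNIV. if i = j \<and> adj S2 u w then 1 else 0 :: real) =
      (\<Sum>j\<in>UNIV. if i = j then \<Sum>w\<in>UNIV. if adj S2 u w then 1 else 0 else 0)"
    by (intro sum.cong) auto
  then show "real (vdegree (S1 \<star>\<^sub>s S2) (Inr (i, u))) = real (vdegree S1 i) + real (vdegree S2 u)"
    unfolding vdegree_eq_sum sum_corona_vertices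
    by (simp add: s_neighbourhood_corona_def sym)
qed

lemma net_degree_s_corona:
  fixes S1 :: "'a::finite pre_signed_graph" and S2 :: "'b::finite pre_signed_graph"
  assumes "signed_graph S1" and "signed_graph S2"
  shows "real_of_int (net_degree (S1 \<star>\<^sub>s S2) (Inl h)) =
      (1 + real CARD('b)) * of_int (net_degree S1 h)"
    and "real_of_int (net_degree (S1 \<star>\<^sub>s S2) (Inr (i, u))) =
      of_int (net_degree S1 i) + of_int (net_degree S2 u)"
proof -
  let ?A = "corona_matrix 0 0 (adjacency_matrix S1) (adjacency_matrix S2)"
  \<comment> \<open>Net degrees are row sums, so applying the block matrix to the all-ones vector
    replaces a count of signed edges.\<close>
  have deg: "real_of_int (net_degree (S1 \<star>\<^sub>s S2) v) = (?A *v 1) $ v" for v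
    using adjacency_matrix_mult_one [OF signed_graph_s_neighbourhood_corona [OF assms]]
    by (simp add: adjacency_matrix_s_corona [OF assms(1)])
  have one: "(\<chi> i. 1) = (1 :: real^'n)" and const: "(\<chi> i. c) = c *\<^sub>R (1 :: real^'n)" for c
    by (simp_all add: vec_eq_iff)
  show "real_of_int (net_degree (S1 \<star>\<^sub>s S2) (Inl h)) =
      (1 + real CARD('b)) * of_int (net_degree S1 h)"
    by (simp add: deg corona_matrix_mult_Inl one const [of "real CARD('b)"]
        matrix_vector_mult_scaleR adjacency_matrix_mult_one assms(1) distrib_right)
  show "real_of_int (net_degree (S1 \<star>\<^sub>s S2) (Inr (i, u))) =
      of_int (net_degree S1 i) + of_int (net_degree S2 u)"
    by (simp add: deg corona_matrix_mult_Inr one adjacency_matrix_mult_one assms)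
qed

lemma laplacian_matrix_s_corona:
  fixes S1 :: "'a::finite pre_signed_graph" and S2 :: "'b::finite pre_signed_graph"
  assumes "signed_graph S1" and r: "\<And>v. vdegree S1 v = r"
  shows "laplacian_matrix (S1 \<star>\<^sub>s S2) = corona_matrix ((1 + real CARD('b)) * real r) (real r)
    (- adjacency_matrix S1) (laplacian_matrix S2)"
  unfolding laplacian_matrix_def adjacency_matrix_s_corona [OF assms(1)]
  by (rule corona_matrix_diagonal_diff) (simp_all add: vdegree_s_corona [OF assms(1)] r)

lemma net_laplacian_matrix_s_corona:
  fixes S1 :: "'a::finite pre_signed_graph" and S2 :: "'b::finite pre_signed_graph"
  assumes "signed_graph S1" and "signed_graph S2" and r: "\<And>v. net_degree S1 v = r"
  shows "net_laplacian_matrix (S1 \<star>\<^sub>s S2) =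
    corona_matrix ((1 + real CARD('b)) * of_int r) (of_int r)
      (- adjacency_matrix S1) (net_laplacian_matrix S2)"
  unfolding net_laplacian_matrix_def adjacency_matrix_s_corona [OF assms(1)]
  by (rule corona_matrix_diagonal_diff) (simp_all add: net_degree_s_corona [OF assms(1,2)] r)

section \<open>The three bounds from the block form\<close>

theorem theorem5p1:
  fixes S1 :: "'a::finite pre_signed_graph" and S2 :: "'b::finite pre_signed_graph"
    and t1 t2 :: nat
  assumes "signed_graph S1" and "signed_graph S2"
    and "1 \<le> t1" and "t1 \<le> CARD('a)" and "1 \<le> t2" and "t2 \<le> CARD('b)"
  shows
    "(net_regular S2 \<and>
      card (spectrum (adjacency_matrix S1)) = t1 \<and>
      card (spectrum (adjacency_matrix S2)) = t2
      \<longrightarrow> finite (spectrum (adjacency_matrix (S1 \<star>\<^sub>s S2))) \<and>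
          card (spectrum (adjacency_matrix (S1 \<star>\<^sub>s S2))) \<le> 2 * t1 + t2)
   \<and> (regular S1 \<and> regular S2 \<and> net_regular S2 \<and>
      card (spectrum (laplacian_matrix S1)) = t1 \<and>
      card (spectrum (laplacian_matrix S2)) = t2
      \<longrightarrow> finite (spectrum (laplacian_matrix (S1 \<star>\<^sub>s S2))) \<and>
          card (spectrum (laplacian_matrix (S1 \<star>\<^sub>s S2))) \<le> 2 * t1 + t2)
   \<and> (net_regular S1 \<and>
      card (spectrum (net_laplacian_matrix S1)) = t1 \<and>
      card (spectrum (net_laplacian_matrix S2)) = t2
      \<longrightarrow> finite (spectrum (net_laplacian_matrix (S1 \<star>\<^sub>s S2))) \<and>
          card (spectrum (net_laplacian_matrix (S1 \<star>\<^sub>s S2))) \<le> 2 * t1 + t2)"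
proof -
  let ?A1 = "adjacency_matrix S1" and ?A2 = "adjacency_matrix S2"
  have A1: "transpose ?A1 = ?A1" and A2: "transpose ?A2 = ?A2"
    using assms(1,2) by (simp_all add: transpose_adjacency_matrix)
  then have negA1: "transpose (- ?A1) = - ?A1"
    using transpose_diff [of 0 ?A1] by (simp add: transpose_def vec_eq_iff)
  text \<open>Since \<^term>\<open>card\<close> is 0 on infinite sets, the bounds on \<open>t1\<close> and \<open>t2\<close> contain finiteness.\<close>
  have bound: "finite (spectrum (corona_matrix a b B K)) \<and>
      card (spectrum (corona_matrix a b B K)) \<le> 2 * t1 + t2"
    if "transpose B = B" "transpose K = K" "K *v 1 = k *\<^sub>R 1"
      "card (spectrum B) = t1" "card (spectrum K) = t2" for a b k and B :: "real^'a^'a" and K :: "real^'b^'b"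
  proof -
    have "finite (spectrum B)" and "finite (spectrum K)"
      using that assms(3,5) by (auto intro: card_ge_0_finite)
    then show ?thesis
      using card_spectrum_corona_matrix [OF that(1-3)] that(4,5) by simp
  qed
  show ?thesis
  proof (intro conjI [OF _ conjI] impI; elim conjE)
    assume "net_regular S2" and t: "card (spectrum ?A1) = t1" "card (spectrum ?A2) = t2"
    then obtain k where "\<And>v. net_degree S2 v = k"
      by (auto simp: net_regular_def)
    then have k: "?A2 *v 1 = of_int k *\<^sub>R 1"
      using adjacency_matrix_mult_one [OF assms(2)] by (simp add: vec_eq_iff)
    show "finite (spectrum (adjacency_matrix (S1 \<star>\<^sub>s S2))) \<and>
        card (spectrum (adjacency_matrix (S1 \<star>\<^sub>s S2))) \<le> 2 * t1 + t2"
      unfolding adjacency_matrix_s_corona [OF assms(1)] by (rule bound [OF A1 A2 k t])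
  next
    assume "regular S1" "regular S2" "net_regular S2"
      and t: "card (spectrum (laplacian_matrix S1)) = t1" "card (spectrum (laplacian_matrix S2)) = t2"
    then obtain r1 r2 k where r1: "\<And>v. vdegree S1 v = r1" and r2: "\<And>v. vdegree S2 v = r2"
      and "\<And>v. net_degree S2 v = k"
      by (auto simp: net_regular_def regular_def)
    \<comment> \<open>A row sum of the Laplacian is degree minus net degree, constant as
      \<open>S2\<close> is both regular and net regular.\<close>
    then have k: "laplacian_matrix S2 *v 1 = (real r2 - of_int k) *\<^sub>R 1"
      using adjacency_matrix_mult_one [OF assms(2)]
      by (simp add: vec_eq_iff laplacian_matrix_def matrix_vector_mult_diff_rdistrib
          diagonal_matrix_mult_one)
    have L2: "transpose (laplacian_matrix S2) = laplacian_matrix S2"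
      by (simp add: laplacian_matrix_def transpose_diff transpose_diagonal_matrix A2)
    have "laplacian_matrix S1 = real r1 *\<^sub>R mat 1 + (- ?A1)"
      by (simp add: laplacian_matrix_def r1 diagonal_matrix_const)
    then have t1: "card (spectrum (- ?A1)) = t1"
      using t(1) card_spectrum_scalar_add [of "real r1" "- ?A1"] by simp
    show "finite (spectrum (laplacian_matrix (S1 \<star>\<^sub>s S2))) \<and>
        card (spectrum (laplacian_matrix (S1 \<star>\<^sub>s S2))) \<le> 2 * t1 + t2"
      unfolding laplacian_matrix_s_corona [OF assms(1) r1] by (rule bound [OF negA1 L2 k t1 t(2)])
  next
    assume "net_regular S1" and t: "card (spectrum (net_laplacian_matrix S1)) = t1"
      "card (spectrum (net_laplacian_matrix S2)) = t2"
    then obtain r where r: "\<And>v. net_degree S1 v = r"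
      by (auto simp: net_regular_def)
    \<comment> \<open>Row sums of a net Laplacian vanish for every signed graph, whence the
      eigenvalue 0.\<close>
    have k: "net_laplacian_matrix S2 *v 1 = 0 *\<^sub>R 1"
      using adjacency_matrix_mult_one [OF assms(2)]
      by (simp add: vec_eq_iff net_laplacian_matrix_def matrix_vector_mult_diff_rdistrib
          diagonal_matrix_mult_one)
    have N2: "transpose (net_laplacian_matrix S2) = net_laplacian_matrix S2"
      by (simp add: net_laplacian_matrix_def transpose_diff transpose_diagonal_matrix A2)
    have "net_laplacian_matrix S1 = of_int r *\<^sub>R mat 1 + (- ?A1)"
      by (simp add: net_laplacian_matrix_def r diagonal_matrix_const)
    then have t1: "card (spectrum (- ?A1)) = t1"
      using t(1) card_spectrum_scalar_add [of "of_int r" "- ?A1"] by simp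
    show "finite (spectrum (net_laplacian_matrix (S1 \<star>\<^sub>s S2))) \<and>
        card (spectrum (net_laplacian_matrix (S1 \<star>\<^sub>s S2))) \<le> 2 * t1 + t2"
      unfolding net_laplacian_matrix_s_corona [OF assms(1,2) r]
      by (rule bound [OF negA1 N2 k t1 t(2)])
  qed
qed

end
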